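(* Let $X=\{1,2,\dots,k\}$ for some integer $k\ge1$. Then Max-$X$-AntiFactor can be solved in polynomial time.
   Context: For fixed $X\subseteq\mathbb{N}$, Max-$X$-AntiFactor is the problem: given an undirected graph $G=(V,E)$, find a set $S\subseteq E$ of maximum size $|S|$ such that $\deg_S(v)\notin X$ for every $v\in V$, where $\deg_S(v)$ is the number of edges of $S$ incident to $v$. *)

theory Defs
  imports "HOL-Computational_Algebra.Polynomial"
begin

section \<open>Multi-tape Turing machines and polynomial time\<close>

datatype move = MLeft | MStay | MRight

text \<open>
  States and tape symbols are the natural numbers below the two given bounds. Symbol 0 is the blank,
  1 and 2 represent the bits. The transition function maps a state and the symbols under the heads
  to a new state and, for each tape, the symbol to be written and the head movement.
\<close>

record tm =
  num_tapes :: nat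
  num_states :: nat
  num_symbols :: nat
  start_state :: nat
  halt_state :: nat
  trans :: "nat \<Rightarrow> nat list \<Rightarrow> nat \<times> (nat \<times> move) list"

text \<open>
  Only the finitely many values of the transition function that are constrained here can be used in
  a run, so a well-formed machine is a finite object.
\<close>

definition wf_tm :: "tm \<Rightarrow> bool" where
  "wf_tm M \<longleftrightarrow>
     num_tapes M \<ge> 1 \<and> num_symbols M \<ge> 3 \<and>
     start_state M < num_states M \<and> halt_state M < num_states M \<and>
     (\<forall>q < num_states M. \<forall>ss. length ss = num_tapes M \<and> set ss \<subseteq> {..<num_symbols M} \<longrightarrow>
        fst (trans M q ss) < num_states M \<and>
        length (snd (trans M q ss)) = num_tapes M \<and>
        (\<forall>(s, d) \<in> set (snd (trans M q ss)). s < num_symbols M))"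

text \<open>A tape is infinite in both directions; it is paired with the position of its head.\<close>

type_synonym tape = "(int \<Rightarrow> nat) \<times> int"
type_synonym config = "nat \<times> tape list"

definition read_tape :: "tape \<Rightarrow> nat" where
  "read_tape tp = fst tp (snd tp)"

fun move_offset :: "move \<Rightarrow> int" where
  "move_offset MLeft = -1"
| "move_offset MStay = 0"
| "move_offset MRight = 1"

definition act_tape :: "nat \<times> move \<Rightarrow> tape \<Rightarrow> tape" where
  "act_tape a tp = ((fst tp)(snd tp := fst a), snd tp + move_offset (snd a))"

definition step_tm :: "tm \<Rightarrow> config \<Rightarrow> config" where
  "step_tm M c =
     (if fst c = halt_state M then c
      else let r = trans M (fst c) (map read_tape (snd c))
           in (fst r, map2 act_tape (snd r) (snd c)))"

definition tape_of :: "bool list \<Rightarrow> int \<Rightarrow> nat" where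
  "tape_of x i = (if 0 \<le> i \<and> nat i < length x then (if x ! nat i then 2 else 1) else 0)"

text \<open>The input is written on the first tape; the output is expected on the last one.\<close>

definition init_config :: "tm \<Rightarrow> bool list \<Rightarrow> config" where
  "init_config M x =
     (start_state M, (tape_of x, 0) # replicate (num_tapes M - 1) (tape_of [], 0))"

text \<open>
  Halting configurations are fixed points of the step function, so the following says that the
  machine halts after at most \<open>t\<close> steps with output \<open>y\<close>.
\<close>

definition outputs_within :: "tm \<Rightarrow> bool list \<Rightarrow> bool list \<Rightarrow> nat \<Rightarrow> bool" where
  "outputs_within M x y t \<longleftrightarrow>
     (let c = (step_tm M ^^ t) (init_config M x)
      in fst c = halt_state M \<and> fst (last (snd c)) = tape_of y)"

text \<open>
  A computational problem is given by a set of instances, their encoding as bit strings, and the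
  relation between instances and correct answers.
\<close>

definition poly_time_solvable ::
    "'a set \<Rightarrow> ('a \<Rightarrow> bool list) \<Rightarrow> ('a \<Rightarrow> bool list \<Rightarrow> bool) \<Rightarrow> bool" where
  "poly_time_solvable I enc correct \<longleftrightarrow>
     (\<exists>M (p :: nat poly). wf_tm M \<and>
        (\<forall>i \<in> I. \<exists>y. correct i y \<and> outputs_within M (enc i) y (poly p (length (enc i)))))"


section \<open>The problem Max-X-AntiFactor\<close>

definition simple_graph :: "'a set \<Rightarrow> 'a set set \<Rightarrow> bool" where
  "simple_graph V E \<longleftrightarrow> finite V \<and> (\<forall>e \<in> E. e \<subseteq> V \<and> card e = 2)"

definition edge_degree :: "'a set set \<Rightarrow> 'a \<Rightarrow> nat" where
  "edge_degree S v = card {e \<in> S. v \<in> e}"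

definition antifactor :: "nat set \<Rightarrow> 'a set \<Rightarrow> 'a set set \<Rightarrow> 'a set set \<Rightarrow> bool" where
  "antifactor X V E S \<longleftrightarrow> S \<subseteq> E \<and> (\<forall>v \<in> V. edge_degree S v \<notin> X)"

definition max_antifactor :: "nat set \<Rightarrow> 'a set \<Rightarrow> 'a set set \<Rightarrow> 'a set set \<Rightarrow> bool" where
  "max_antifactor X V E S \<longleftrightarrow>
     antifactor X V E S \<and> (\<forall>T. antifactor X V E T \<longrightarrow> card T \<le> card S)"

text \<open>
  The instance \<open>(n, E)\<close> is the graph with vertex set \<open>{0, \<dots>, n - 1}\<close> and edge set \<open>E\<close>. It is
  encoded by \<open>n\<close> in unary, a terminating \<open>0\<close>, and the rows of the adjacency matrix.
\<close>

definition graph_instances :: "(nat \<times> nat set set) set" where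
  "graph_instances = {(n, E). simple_graph {..<n} E}"

definition encode_graph :: "nat \<times> nat set set \<Rightarrow> bool list" where
  "encode_graph = (\<lambda>(n, E).
     replicate n True @ [False] @ concat (map (\<lambda>i. map (\<lambda>j. {i, j} \<in> E) [0..<n]) [0..<n]))"

text \<open>
  A solution \<open>S\<close> is output as the encoding of the subgraph with edge set \<open>S\<close>. For general \<open>X\<close>
  (with \<open>0 \<in> X\<close>) there may be no feasible \<open>S\<close>, which is reported by the empty string; this is not
  the encoding of any graph.
\<close>

definition max_antifactor_answer :: "nat set \<Rightarrow> nat \<times> nat set set \<Rightarrow> bool list \<Rightarrow> bool" where
  "max_antifactor_answer X = (\<lambda>(n, E) y.
     if \<exists>S. antifactor X {..<n} E S
     then \<exists>S. max_antifactor X {..<n} E S \<and> y = encode_graph (n, S)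
     else y = [])"

definition Max_AntiFactor_poly_time :: "nat set \<Rightarrow> bool" where
  "Max_AntiFactor_poly_time X \<longleftrightarrow>
     poly_time_solvable graph_instances encode_graph (max_antifactor_answer X)"

lemma replicate_True_False_eqD:
  "replicate m True @ False # xs = replicate n True @ False # ys \<Longrightarrow> m = n \<and> xs = ys"
proof (induction m arbitrary: n)
  case 0 then show ?case by (cases n) auto
next
  case (Suc m) then show ?case by (cases n) auto
qed

lemma inj_on_encode_graph: "inj_on encode_graph graph_instances"
proof (rule inj_onI, clarify)
  fix n E n' E'
  assume G: "(n, E) \<in> graph_instances" and G': "(n', E') \<in> graph_instances"
    and eq: "encode_graph (n, E) = encode_graph (n', E')"
  let ?rows = "\<lambda>E. map (\<lambda>i. map (\<lambda>j. {i, j} \<in> E) [0..<n]) [0..<n]"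
  from eq have n: "n' = n" and c: "concat (?rows E) = concat (?rows E')"
    by (auto simp: encode_graph_def dest!: replicate_True_False_eqD)
  have "?rows E = ?rows E'"
  proof (rule iffD1[OF concat_eq_concat_iff c])
    show "\<forall>(x, y) \<in> set (zip (?rows E) (?rows E')). length x = length y"
      by (auto simp: in_set_zip)
  qed simp
  then have pq: "{i, j} \<in> E \<longleftrightarrow> {i, j} \<in> E'" if "i < n" "j < n" for i j
    using that by (auto simp: map_eq_conv)
  have "e \<in> E \<longleftrightarrow> e \<in> E'" for e
  proof -
    have "\<exists>i j. e = {i, j} \<and> i < n \<and> j < n" if "e \<in> E \<or> e \<in> E'"
    proof -
      have "e \<subseteq> {..<n}" "card e = 2"
        using that G G' n by (auto simp: graph_instances_def simple_graph_def)
      then show ?thesis by (auto simp: card_2_iff)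
    qed
    then show ?thesis using pq by blast
  qed
  then show "n = n' \<and> E = E'" using n by blast
qed

end

theory Submission
  imports Defs
begin

text \<open>
  For \<open>X = {1, \<dots>, k}\<close> every vertex covered by an antifactor has degree at least \<open>k + 1\<close> in it.
  So if all antifactors live on a vertex set \<open>A\<close>, none of them covers a vertex with at most \<open>k\<close>
  neighbours in \<open>A\<close>, and such vertices can be removed from \<open>A\<close>. Starting with all vertices, this
  peeling stabilises after at most \<open>n\<close> rounds at the \<open>(k + 1)\<close>-core, whose edge set is itself an
  antifactor and contains all others. Since \<open>k\<close> is fixed, a Turing machine can count neighbours up
  to \<open>k + 1\<close> in its finite control, and a round is a single sweep over the adjacency matrix.
\<close>

section \<open>Peeling\<close>

text \<open>The map from \<open>j\<close> to \<open>{v, j}\<close> is onto the edges at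
  \<open>v\<close> because every edge has two elements. This links degrees, which count edges, to
  the neighbour counts of the machine.\<close>

lemma edge_degree_eq_card_neighbours:
  assumes "simple_graph V S"
  shows "edge_degree S v = card {j. {v, j} \<in> S}"
proof -
  have "bij_betw (\<lambda>j. {v, j}) {j. {v, j} \<in> S} {e \<in> S. v \<in> e}"
    unfolding bij_betw_def
  proof
    show "inj_on (\<lambda>j. {v, j}) {j. {v, j} \<in> S}"
      by (auto simp: inj_on_def doubleton_eq_iff)
    show "(\<lambda>j. {v, j}) ` {j. {v, j} \<in> S} = {e \<in> S. v \<in> e}"
    proof
      show "{e \<in> S. v \<in> e} \<subseteq> (\<lambda>j. {v, j}) ` {j. {v, j} \<in> S}"
      proof
        fix e assume e: "e \<in> {e \<in> S. v \<in> e}"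
        then have "card e = 2" using assms by (auto simp: simple_graph_def)
        then obtain j where "e = {v, j}" using e by (auto simp: card_2_iff)
        then show "e \<in> (\<lambda>j. {v, j}) ` {j. {v, j} \<in> S}" using e by auto
      qed
    qed auto
  qed
  then show ?thesis unfolding edge_degree_def by (metis bij_betw_same_card)
qed

definition peel :: "nat \<Rightarrow> 'a set set \<Rightarrow> 'a set \<Rightarrow> 'a set" where
  "peel k E A = {i \<in> A. k < card {j \<in> A. {i, j} \<in> E}}"

definition induced_edges :: "'a set set \<Rightarrow> 'a set \<Rightarrow> 'a set set" where
  "induced_edges E A = {e \<in> E. e \<subseteq> A}"

lemma simple_graph_subset: "simple_graph V E \<Longrightarrow> S \<subseteq> E \<Longrightarrow> simple_graph V S"
  by (auto simp: simple_graph_def)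

lemma simple_graph_finite_edges:
  assumes "simple_graph V E"
  shows "finite E"
proof (rule finite_subset)
  show "E \<subseteq> Pow V" using assms by (auto simp: simple_graph_def)
qed (use assms in \<open>auto simp: simple_graph_def\<close>)

text \<open>A vertex covered by \<open>T\<close> has nonzero degree outside \<open>{1..k}\<close>,
  hence more than \<open>k\<close> neighbours via \<open>T\<close>, all of them in \<open>A\<close>.
  This is the invariant that every round preserves.\<close>

lemma antifactor_Union_subset_peel:
  assumes G: "simple_graph V E" and T: "antifactor {1..k} V E T"
    and A: "A \<subseteq> V" and sub: "\<Union>T \<subseteq> A"
  shows "\<Union>T \<subseteq> peel k E A"
proof
  fix v assume v: "v \<in> \<Union>T"
  have TE: "T \<subseteq> E" using T by (auto simp: antifactor_def)
  have sT: "simple_graph V T" using simple_graph_subset[OF G TE] .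
  have fA: "finite A" using A G finite_subset by (auto simp: simple_graph_def)
  have vA: "v \<in> A" using v sub by auto
  have "{e \<in> T. v \<in> e} \<noteq> {}" using v by auto
  then have "edge_degree T v \<noteq> 0"
    using simple_graph_finite_edges[OF sT] by (simp add: edge_degree_def)
  moreover have "edge_degree T v \<notin> {1..k}" using T vA A by (auto simp: antifactor_def)
  ultimately have "k < edge_degree T v" by auto
  also have "\<dots> = card {j. {v, j} \<in> T}" by (rule edge_degree_eq_card_neighbours[OF sT])
  also have "\<dots> \<le> card {j \<in> A. {v, j} \<in> E}"
    using fA sub TE by (intro card_mono) auto
  finally show "v \<in> peel k E A" using vA by (simp add: peel_def)
qed

text \<open>At a fixed point, degrees at vertices of \<open>A\<close> exceed \<open>k\<close> and
  all others are 0, so the induced edges are feasible. By the invariant they contain every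
  antifactor.\<close>

lemma max_antifactor_induced_edges:
  assumes G: "simple_graph V E" and A: "A \<subseteq> V" and fix_A: "peel k E A = A"
    and inv: "\<And>T. antifactor {1..k} V E T \<Longrightarrow> \<Union>T \<subseteq> A"
  shows "max_antifactor {1..k} V E (induced_edges E A)"
proof -
  have sub: "induced_edges E A \<subseteq> E" by (auto simp: induced_edges_def)
  note sS = simple_graph_subset[OF G sub]
  have "edge_degree (induced_edges E A) v \<notin> {1..k}" for v
  proof (cases "v \<in> A")
    case True
    then have "k < card {j \<in> A. {v, j} \<in> E}" using fix_A by (auto simp: peel_def)
    also have "{j \<in> A. {v, j} \<in> E} = {j. {v, j} \<in> induced_edges E A}"
      using True by (auto simp: induced_edges_def)
    finally show ?thesis using edge_degree_eq_card_neighbours[OF sS] by simp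
  next
    case False
    then have "{e \<in> induced_edges E A. v \<in> e} = {}" by (auto simp: induced_edges_def)
    then show ?thesis unfolding edge_degree_def by (metis atLeastAtMost_iff card.empty not_one_le_zero)
  qed
  moreover have "card T \<le> card (induced_edges E A)" if T: "antifactor {1..k} V E T" for T
  proof (rule card_mono)
    show "T \<subseteq> induced_edges E A"
      using inv[OF T] T by (auto simp: antifactor_def induced_edges_def)
  qed (rule simple_graph_finite_edges[OF sS])
  ultimately show ?thesis using sub by (auto simp: max_antifactor_def antifactor_def)
qed


section \<open>Tapes holding graphs and vertex sets\<close>

text \<open>The number of rows \<open>m\<close> is kept apart from the row length \<open>n\<close>,
  so that the induction can append one row at a time.\<close>

lemma nth_concat_map_upt:
  "i < m \<Longrightarrow> j < n \<Longrightarrow>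
     concat (map (\<lambda>i. map (f i) [0..<n]) [0..<m]) ! (i * n + j) = f i j"
proof (induction m)
  case (Suc m)
  have len: "length (concat (map (\<lambda>i. map (f i) [0..<n]) [0..<m])) = m * n"
    by (simp add: length_concat comp_def sum_list_triv)
  show ?case
  proof (cases "i < m")
    case True
    have "i * n + j < i * n + n" using Suc.prems by simp
    also have "\<dots> = Suc i * n" by simp
    also have "\<dots> \<le> m * n" using True by (intro mult_right_mono) auto
    finally show ?thesis using True Suc len by (simp add: nth_append)
  next
    case False
    then have "i = m" using Suc.prems by simp
    then show ?thesis using Suc.prems len by (simp add: nth_append)
  qed
qed simp

lemma length_encode_graph: "length (encode_graph (n, S)) = n + 1 + n * n"
  by (simp add: encode_graph_def length_concat comp_def sum_list_triv)

definition graph_tape :: "nat \<Rightarrow> nat set set \<Rightarrow> int \<Rightarrow> nat" where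
  "graph_tape n S = tape_of (encode_graph (n, S))"

lemma graph_tape_neg: "x < 0 \<Longrightarrow> graph_tape n S x = 0"
  by (simp add: graph_tape_def tape_of_def)

lemma graph_tape_end: "int (n + 1 + n * n) \<le> x \<Longrightarrow> graph_tape n S x = 0"
  by (auto simp: graph_tape_def tape_of_def length_encode_graph simp del: of_nat_add of_nat_mult)

lemma graph_tape_nonblank: "0 \<le> x \<Longrightarrow> x < int (n + 1 + n * n) \<Longrightarrow> graph_tape n S x \<noteq> 0"
  by (auto simp: graph_tape_def tape_of_def length_encode_graph simp del: of_nat_add of_nat_mult)

lemma graph_tape_unary: "m < n \<Longrightarrow> graph_tape n S (int m) = 2"
  by (simp add: graph_tape_def tape_of_def length_encode_graph)
     (simp add: encode_graph_def nth_append)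

lemma graph_tape_separator: "graph_tape n S (int n) = 1"
  by (simp add: graph_tape_def tape_of_def length_encode_graph)
     (simp add: encode_graph_def nth_append)

lemma graph_tape_matrix:
  assumes "i < n" "j < n"
  shows "graph_tape n S (int (n + 1 + i * n + j)) = (if {i, j} \<in> S then 2 else 1)"
proof -
  have "i * n + j < Suc i * n" using assms by simp
  also have "\<dots> \<le> n * n" using assms by (intro mult_right_mono) auto
  finally have lt: "i * n + j < n * n" .
  have "encode_graph (n, S) ! (n + 1 + i * n + j) =
      concat (map (\<lambda>i. map (\<lambda>j. {i, j} \<in> S) [0..<n]) [0..<n]) ! (i * n + j)"
    by (simp add: encode_graph_def nth_append add.assoc)
  also have "\<dots> = ({i, j} \<in> S)" by (rule nth_concat_map_upt[OF assms])
  finally show ?thesis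
    using lt unfolding graph_tape_def tape_of_def length_encode_graph nat_int by simp
qed

text \<open>The blanks on both sides are end markers for the heads. Elements from \<open>n\<close>
  on leave no trace, so \<open>UNIV\<close> can stand for the full vertex set.\<close>

definition set_tape :: "nat \<Rightarrow> nat set \<Rightarrow> int \<Rightarrow> nat" where
  "set_tape n A x = (if 0 \<le> x \<and> x < int n then if nat x \<in> A then 2 else 1 else 0)"

lemma set_tape_int: "m < n \<Longrightarrow> set_tape n A (int m) = (if m \<in> A then 2 else 1)"
  by (simp add: set_tape_def)

lemma set_tape_outside [simp]: "set_tape n A (int n) = 0" "set_tape n A (- 1) = 0"
  by (simp_all add: set_tape_def)

lemma set_tape_upd:
  "m < n \<Longrightarrow> (set_tape n A)(int m := (if b then 2 else 1)) =
     set_tape n (if b then insert m A else A - {m})"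
  by (auto simp: set_tape_def fun_eq_iff)

lemma set_tape_extend: "(set_tape m UNIV)(int m := 2) = set_tape (Suc m) UNIV"
  by (auto simp: set_tape_def fun_eq_iff)

lemma set_tape_cong: "(\<And>i. i < n \<Longrightarrow> i \<in> A \<longleftrightarrow> i \<in> B) \<Longrightarrow> set_tape n A = set_tape n B"
  by (auto simp: set_tape_def fun_eq_iff)

text \<open>The part before the matrix depends on \<open>n\<close> alone, so the output tape
  receives it once and keeps it in all rounds.\<close>

lemma graph_tape_prefix:
  assumes x: "x \<le> int n"
  shows "graph_tape n S x = ((set_tape n UNIV)(int n := 1)) x"
proof -
  consider "x < 0" | m where "x = int m" "m < n" | "x = int n"
    using x by (metis le_less nonneg_int_cases not_le of_nat_less_iff)
  then show ?thesis
    by cases (simp_all add: graph_tape_neg graph_tape_unary graph_tape_separator set_tape_def)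
qed

text \<open>Models the output tape during a sweep, with \<open>f\<close> the new contents,
  \<open>g\<close> the old ones and \<open>p\<close> the head position.\<close>

definition splice_tape :: "(int \<Rightarrow> nat) \<Rightarrow> (int \<Rightarrow> nat) \<Rightarrow> int \<Rightarrow> int \<Rightarrow> nat" where
  "splice_tape f g p x = (if x < p then f x else g x)"

lemma splice_tape_upd: "(splice_tape f g p)(p := f p) = splice_tape f g (p + 1)"
  by (auto simp: splice_tape_def fun_eq_iff)


section \<open>Bounded reachability\<close>

text \<open>Only an upper bound on the number of steps is recorded, so running times can be rounded
  up when runs are composed.\<close>

definition reaches :: "tm \<Rightarrow> nat \<Rightarrow> config \<Rightarrow> config \<Rightarrow> bool" where
  "reaches M t c d \<longleftrightarrow> (\<exists>s \<le> t. (step_tm M ^^ s) c = d)"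

lemma reaches_refl: "reaches M t c c"
  unfolding reaches_def by (rule exI[of _ 0]) simp

lemma reaches_trans:
  assumes "reaches M s c d" "reaches M t d e" "s + t \<le> u"
  shows "reaches M u c e"
proof -
  obtain s' t' where "s' \<le> s" "(step_tm M ^^ s') c = d" "t' \<le> t" "(step_tm M ^^ t') d = e"
    using assms by (auto simp: reaches_def)
  then have "(step_tm M ^^ (t' + s')) c = e" "t' + s' \<le> u"
    using assms(3) by (simp_all add: funpow_add)
  then show ?thesis unfolding reaches_def by blast
qed

lemma reaches_step: "step_tm M c = d \<Longrightarrow> reaches M 1 c d"
  unfolding reaches_def by (rule exI[of _ 1]) simp

lemma halted_funpow: "fst c = halt_state M \<Longrightarrow> (step_tm M ^^ t) c = c"
  by (induction t) (simp_all add: step_tm_def)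

text \<open>A halted run can be padded to exactly \<open>t\<close> steps, the form that
  \<open>outputs_within\<close> asks for.\<close>

lemma reaches_halted:
  assumes "reaches M t c d" "fst d = halt_state M"
  shows "(step_tm M ^^ t) c = d"
proof -
  obtain s where s: "s \<le> t" "(step_tm M ^^ s) c = d" using assms by (auto simp: reaches_def)
  have "(step_tm M ^^ t) c = (step_tm M ^^ (t - s)) ((step_tm M ^^ s) c)"
    using s(1) by (simp flip: funpow_add[unfolded comp_def, THEN fun_cong] add: comp_def)
  then show ?thesis using s halted_funpow assms(2) by simp
qed


section \<open>The peeling machine\<close>

text \<open>
  Tape 0 is the input, which is never changed. Tapes 1 and 2 hold characteristic vectors of vertex
  sets: tape 1 the set \<open>A\<close> at the start of the round (its head is at the current column), tape 2 the
  same set, overwritten row by row by the peeled set (its head is at the current row). Tape 3 is the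
  output; its head is always at the position of the head of tape 0, and each round overwrites it by
  the matrix of the graph induced on \<open>A\<close>, which is the answer if the round removes no vertex.

  States: 0 initialises tapes 1 to 3; 1 tests whether there is another row; 2 moves the head of tape 1
  back to column 0; \<open>8 + c\<close> scans a row, having seen \<open>c\<close> neighbours in \<open>A\<close> (capped at \<open>k + 1\<close>);
  3 and 4 copy tape 2 to tape 1 from right to left, where 4 records that another round is needed;
  5 and 6 move the heads of tapes 0 and 3 back to the start of the matrix; 7 halts.
\<close>

definition peel_trans :: "nat \<Rightarrow> nat \<Rightarrow> nat list \<Rightarrow> nat \<times> (nat \<times> move) list" where
  "peel_trans k q ss =
    (let a = ss ! 0; b = ss ! 1; c = ss ! 2; d = ss ! 3 in
     if q = 0 then
       if a = 2 then (0, [(a, MRight), (2, MRight), (2, MRight), (2, MRight)])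
       else (4, [(a, MStay), (b, MLeft), (c, MLeft), (1, MStay)])
     else if q = 1 then
       if c = 0 then (3, [(a, MStay), (b, MLeft), (c, MLeft), (d, MStay)])
       else (2, [(a, MStay), (b, MLeft), (c, MStay), (d, MStay)])
     else if q = 2 then
       if b = 0 then (8, [(a, MStay), (b, MRight), (c, MStay), (d, MStay)])
       else (2, [(a, MStay), (b, MLeft), (c, MStay), (d, MStay)])
     else if q = 3 \<or> q = 4 then
       if b \<noteq> 0 then
         (if b = c then q else 4, [(a, MStay), (c, MLeft), (c, MLeft), (d, MStay)])
       else if q = 3 then (7, [(a, MStay), (b, MStay), (c, MStay), (d, MStay)])
       else (5, [(a, MLeft), (b, MRight), (c, MRight), (d, MLeft)])
     else if q = 5 then
       if a = 0 then (6, [(a, MRight), (b, MStay), (c, MStay), (d, MRight)])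
       else (5, [(a, MLeft), (b, MStay), (c, MStay), (d, MLeft)])
     else if q = 6 then
       if a = 2 then (6, [(a, MRight), (b, MRight), (c, MStay), (d, MRight)])
       else (1, [(a, MRight), (b, MStay), (c, MStay), (d, MRight)])
     else
       if b = 0 then
         (1, [(a, MStay), (b, MStay),
              (if c = 2 \<and> q = 9 + k then 2 else 1, MRight), (d, MStay)])
       else
         (if a = 2 \<and> b = 2 then min (9 + k) (Suc q) else q,
          [(a, MRight), (b, MRight), (c, MStay),
           (if a = 2 \<and> b = 2 \<and> c = 2 then 2 else 1, MRight)]))"

definition peel_tm :: "nat \<Rightarrow> tm" where
  "peel_tm k = \<lparr>num_tapes = 4, num_states = 10 + k, num_symbols = 3,
     start_state = 0, halt_state = 7, trans = peel_trans k\<rparr>"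

lemma wf_peel_tm: "wf_tm (peel_tm k)"
proof -
  \<comment> \<open>One predicate for all requirements on a transition, so that \<open>ok_if\<close>
    can descend through the nested conditionals of \<open>peel_trans\<close>.\<close>
  define ok where "ok r \<longleftrightarrow> fst r < 10 + k \<and> length (snd r) = 4 \<and>
      (\<forall>(s, d) \<in> set (snd r). s < 3)" for r :: "nat \<times> (nat \<times> move) list"
  have ok_Pair: "ok (q, [x, y, z, w]) \<longleftrightarrow>
      q < 10 + k \<and> fst x < 3 \<and> fst y < 3 \<and> fst z < 3 \<and> fst w < 3" for q x y z w
    by (auto simp: ok_def)
  have ok_if: "(b \<Longrightarrow> ok r) \<Longrightarrow> (\<not> b \<Longrightarrow> ok r') \<Longrightarrow> ok (if b then r else r')" for b r r'
    by simp
  have "ok (peel_trans k q ss)"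
    if q: "q < 10 + k" and len: "length ss = 4" and sub: "set ss \<subseteq> {..<3}" for q ss
  proof -
    have "ss ! i < 3" if "i < 4" for i
      using nth_mem[of i ss] sub len that by (metis lessThan_iff subsetD)
    from this[of 0] this[of 1] this[of 2] this[of 3]
    have "ss ! 0 < 3" "ss ! 1 < 3" "ss ! 2 < 3" "ss ! 3 < 3" by simp_all
    then show ?thesis
      using q unfolding peel_trans_def Let_def
      by (intro ok_if) (simp_all add: ok_Pair min_less_iff_disj)
  qed
  then show ?thesis unfolding ok_def by (simp add: wf_tm_def peel_tm_def) blast
qed

section \<open>Sweeps of the machine on a fixed graph\<close>

locale peeling =
  fixes k n :: nat and E :: "nat set set"
  assumes graph: "simple_graph {..<n} E"
begin

abbreviation "reach \<equiv> reaches (peel_tm k)"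

abbreviation "input_tape \<equiv> graph_tape n E"

abbreviation "enc_len \<equiv> n + 1 + n * n"

definition conf :: "nat \<Rightarrow> int \<Rightarrow> (int \<Rightarrow> nat) \<Rightarrow> int \<Rightarrow> (int \<Rightarrow> nat) \<Rightarrow> int \<Rightarrow> (int \<Rightarrow> nat) \<Rightarrow> config"
  where "conf q p f g f' g' out = (q, [(input_tape, p), (f, g), (f', g'), (out, p)])"

lemma step_conf:
  "q \<noteq> 7 \<Longrightarrow> step_tm (peel_tm k) (conf q p f g f' g' out) =
     (let r = peel_trans k q [input_tape p, f g, f' g', out p]
      in (fst r, map2 act_tape (snd r) [(input_tape, p), (f, g), (f', g'), (out, p)]))"
  by (simp add: step_tm_def conf_def peel_tm_def read_tape_def)

lemma eq_conf_iff:
  "c = conf q p f g f' g' out \<longleftrightarrow> c = (q, [(input_tape, p), (f, g), (f', g'), (out, p)])"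
  by (simp add: conf_def)

text \<open>\<open>fun_upd_idem\<close> discards the writing back of a symbol just read, so
  untouched tapes keep their form.\<close>

lemmas step_simps = step_conf eq_conf_iff peel_trans_def act_tape_def fun_upd_idem Let_def

lemma init_loop:
  "m \<le> n \<Longrightarrow> reach m
     (conf 0 0 (set_tape 0 UNIV) 0 (set_tape 0 UNIV) 0 (set_tape 0 UNIV))
     (conf 0 (int m) (set_tape m UNIV) (int m) (set_tape m UNIV) (int m) (set_tape m UNIV))"
proof (induction m)
  case 0 then show ?case by (simp add: reaches_refl)
next
  case (Suc m)
  let ?t = "set_tape m UNIV" and ?t' = "set_tape (Suc m) UNIV"
  have "step_tm (peel_tm k) (conf 0 (int m) ?t (int m) ?t (int m) ?t) =
      conf 0 (int (Suc m)) ?t' (int (Suc m)) ?t' (int (Suc m)) ?t'"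
    using Suc.prems graph_tape_unary[of m n E] set_tape_extend[of m]
    by (simp add: step_simps)
  then show ?case using reaches_trans[OF Suc.IH reaches_step] Suc.prems by simp
qed

text \<open>Cells from \<open>m\<close> on are already copied, and \<open>c\<close> tells whether a
  difference has been found so far. The induction changes this flag, so it must be
  arbitrary.\<close>

lemma copy_loop:
  assumes "m \<le> n"
  shows "reach m
     (conf (if c then 4 else 3) p (set_tape n (A \<inter> {..<m} \<union> B \<inter> {m..})) (int m - 1)
       (set_tape n B) (int m - 1) out)
     (conf (if c \<or> (\<exists>i<m. (i \<in> A) \<noteq> (i \<in> B)) then 4 else 3) p (set_tape n B) (- 1)
       (set_tape n B) (- 1) out)"
  using assms
proof (induction m arbitrary: c)
  case 0
  have "set_tape n (A \<inter> {..<0} \<union> B \<inter> {0..}) = set_tape n B" by (rule set_tape_cong) auto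
  then show ?case by (simp add: reaches_refl)
next
  case (Suc m)
  let ?A = "\<lambda>m. set_tape n (A \<inter> {..<m} \<union> B \<inter> {m..})"
  let ?c = "c \<or> (m \<in> A) \<noteq> (m \<in> B)"
  have m: "m < n" using Suc.prems by simp
  have upd: "(?A (Suc m))(int m := (if m \<in> B then 2 else 1)) = ?A m"
    unfolding set_tape_upd[OF m] by (rule set_tape_cong) (auto simp: less_Suc_eq_le le_less not_less_eq)
  have "step_tm (peel_tm k) (conf (if c then 4 else 3) p (?A (Suc m)) (int (Suc m) - 1)
          (set_tape n B) (int (Suc m) - 1) out) =
      conf (if ?c then 4 else 3) p (?A m) (int m - 1) (set_tape n B) (int m - 1) out"
    using upd m by (cases c) (auto simp: step_simps set_tape_int)
  from reaches_trans[OF reaches_step[OF this] Suc.IH[of ?c]] Suc.prems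
  show ?case by (simp add: less_Suc_eq ex_disj_distrib conj_disj_distribR disj_commute disj_left_commute)
qed

text \<open>The input has no blank inside, so the first blank met is at -1; one more step turns back
  to 0.\<close>

lemma rewind_loop:
  "m \<le> enc_len \<Longrightarrow> reach (m + 1) (conf 5 (int m - 1) f g f' g' out) (conf 6 0 f g f' g' out)"
proof (induction m)
  case 0
  show ?case
    by (rule reaches_step[THEN reaches_trans, OF _ reaches_refl])
       (simp_all add: step_simps graph_tape_neg)
next
  case (Suc m)
  have "step_tm (peel_tm k) (conf 5 (int (Suc m) - 1) f g f' g' out) =
      conf 5 (int m - 1) f g f' g' out"
    using graph_tape_nonblank[of "int m" n E, unfolded of_nat_less_iff] Suc.prems
    by (simp add: step_simps)
  from reaches_trans[OF reaches_step[OF this] Suc.IH] Suc.prems show ?case by simp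
qed

text \<open>Tape 1 moves along with tape 0 over the unary part. This puts its head at
  \<open>n\<close>, just behind the vector, where state 1 expects it.\<close>

lemma skip_loop:
  "m \<le> n \<Longrightarrow> reach m (conf 6 0 f 0 f' g' out) (conf 6 (int m) f (int m) f' g' out)"
proof (induction m)
  case 0 then show ?case by (simp add: reaches_refl)
next
  case (Suc m)
  have "step_tm (peel_tm k) (conf 6 (int m) f (int m) f' g' out) =
      conf 6 (int (Suc m)) f (int (Suc m)) f' g' out"
    using Suc.prems graph_tape_unary[of m n E]
    by (simp add: step_simps)
  then show ?case using reaches_trans[OF Suc.IH reaches_step] Suc.prems by simp
qed

lemma skip: "reach (n + 1) (conf 6 0 f 0 f' g' out) (conf 1 (int (n + 1)) f (int n) f' g' out)"
proof -
  have "step_tm (peel_tm k) (conf 6 (int n) f (int n) f' g' out) =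
      conf 1 (int (n + 1)) f (int n) f' g' out"
    using graph_tape_separator[of n E]
    by (simp add: step_simps)
  then show ?thesis using reaches_trans[OF skip_loop[OF order_refl] reaches_step] by simp
qed

lemma restart:
  assumes "m \<le> enc_len"
  shows "reach (enc_len + n + 4) (conf 4 (int m) (set_tape n A) (- 1) (set_tape n A) (- 1) out)
     (conf 1 (int (n + 1)) (set_tape n A) (int n) (set_tape n A) 0 out)"
proof -
  \<comment> \<open>The move to the left on leaving state 4 matters: after a round the head is on
    the blank behind the input, which state 5 would take for the left end.\<close>
  have 1: "step_tm (peel_tm k) (conf 4 (int m) (set_tape n A) (- 1) (set_tape n A) (- 1) out) =
      conf 5 (int m - 1) (set_tape n A) 0 (set_tape n A) 0 out"
    by (simp add: step_simps)
  show ?thesis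
    by (rule reaches_trans[OF reaches_step[OF 1]
          reaches_trans[OF rewind_loop[OF assms] skip order_refl]]) (use assms in simp)
qed

section \<open>Processing the rows of the adjacency matrix\<close>

lemma return_loop:
  "m \<le> n \<Longrightarrow> reach (m + 1) (conf 2 p (set_tape n A) (int m - 1) f' g' out)
     (conf 8 p (set_tape n A) 0 f' g' out)"
proof (induction m)
  case 0
  show ?case
    by (rule reaches_step[THEN reaches_trans, OF _ reaches_refl])
       (simp_all add: step_simps)
next
  case (Suc m)
  have "step_tm (peel_tm k) (conf 2 p (set_tape n A) (int (Suc m) - 1) f' g' out) =
      conf 2 p (set_tape n A) (int m - 1) f' g' out"
    using Suc.prems
    by (simp add: step_simps set_tape_int)
  from reaches_trans[OF reaches_step[OF this] Suc.IH] Suc.prems show ?case by simp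
qed

definition target :: "nat set \<Rightarrow> int \<Rightarrow> nat" where
  "target A = graph_tape n (induced_edges E A)"

text \<open>The three symbols under the heads tell whether \<open>{i, j}\<close> is an edge, whether
  \<open>j\<close> is in \<open>A\<close> and whether \<open>i\<close> is in \<open>A\<close>; they
  determine both the output bit and the count. Capping at \<open>k + 1\<close> keeps the test for
  more than \<open>k\<close> neighbours exact.\<close>

lemma scan_loop:
  assumes i: "i < n" and f': "f' (int i) = (if i \<in> A then 2 else 1)"
  shows "j \<le> n \<Longrightarrow> reach j
     (conf 8 (int (n + 1 + i * n)) (set_tape n A) 0 f' (int i)
        (splice_tape (target A) out (int (n + 1 + i * n))))
     (conf (8 + min (k + 1) (card {l \<in> A. l < j \<and> {i, l} \<in> E})) (int (n + 1 + i * n + j))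
        (set_tape n A) (int j) f' (int i)
        (splice_tape (target A) out (int (n + 1 + i * n + j))))"
proof (induction j)
  case 0 then show ?case by (simp add: reaches_refl)
next
  case (Suc j)
  let ?C = "\<lambda>j. {l \<in> A. l < j \<and> {i, l} \<in> E}"
  let ?p = "int (n + 1 + i * n + j)"
  let ?o = "splice_tape (target A) out"
  have j: "j < n" using Suc.prems by simp
  have card: "card (?C (Suc j)) = (if j \<in> A \<and> {i, j} \<in> E then Suc (card (?C j)) else card (?C j))"
  proof (cases "j \<in> A \<and> {i, j} \<in> E")
    case True
    then have "?C (Suc j) = insert j (?C j)" by (auto simp: less_Suc_eq)
    moreover have "finite (?C j)" by simp
    ultimately show ?thesis using True by simp
  next
    case False
    then have "?C (Suc j) = ?C j" by (auto simp: less_Suc_eq)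
    then show ?thesis using False by auto
  qed
  have inp: "input_tape ?p = (if {i, j} \<in> E then 2 else 1)" by (rule graph_tape_matrix[OF i j])
  have "target A ?p = (if {i, j} \<in> induced_edges E A then 2 else 1)"
    unfolding target_def by (rule graph_tape_matrix[OF i j])
  then have tgt: "target A ?p = (if {i, j} \<in> E \<and> j \<in> A \<and> i \<in> A then 2 else 1)"
    by (auto simp: induced_edges_def)
  have next_p: "int (n + 1 + i * n + Suc j) = ?p + 1" by simp
  \<comment> \<open>Writing the symbol of \<open>target A\<close> at \<open>?p\<close> shifts the
    splice boundary by one cell.\<close>
  have upd: "(?o ?p)(?p := (if {i, j} \<in> E \<and> j \<in> A \<and> i \<in> A then 2 else 1)) = ?o (?p + 1)"
    using splice_tape_upd[of "target A" out ?p] tgt by simp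
  have "step_tm (peel_tm k) (conf (8 + min (k + 1) (card (?C j))) ?p (set_tape n A) (int j)
           f' (int i) (?o ?p)) =
      conf (8 + min (k + 1) (card (?C (Suc j)))) (?p + 1) (set_tape n A) (int (Suc j)) f' (int i)
           (?o (?p + 1))"
    unfolding card upd[symmetric]
    using j inp f'
    by (auto simp: step_simps set_tape_int
             simp del: of_nat_add of_nat_mult)
  then show ?case
    unfolding next_p using reaches_trans[OF Suc.IH reaches_step] Suc.prems by simp
qed

text \<open>The contents of tape 2 when the first \<open>i\<close> rows have been processed.\<close>

definition mixed :: "nat set \<Rightarrow> nat \<Rightarrow> nat set" where
  "mixed A i = peel k E A \<inter> {..<i} \<union> A \<inter> {i..}"

text \<open>Neighbours are counted on tape 1, which keeps the old \<open>A\<close>, so earlier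
  changes to tape 2 do not affect the count. Returning takes \<open>n + 1\<close> steps, scanning
  \<open>n\<close>, and entering and leaving the row one each.\<close>

lemma row:
  assumes i: "i < n" and A: "A \<subseteq> {..<n}"
  shows "reach (2 * n + 3)
     (conf 1 (int (n + 1 + i * n)) (set_tape n A) (int n) (set_tape n (mixed A i)) (int i)
        (splice_tape (target A) out (int (n + 1 + i * n))))
     (conf 1 (int (n + 1 + Suc i * n)) (set_tape n A) (int n) (set_tape n (mixed A (Suc i)))
        (int (Suc i)) (splice_tape (target A) out (int (n + 1 + Suc i * n))))"
proof -
  let ?o = "splice_tape (target A) out"
  let ?p = "int (n + 1 + i * n)" and ?p' = "int (n + 1 + i * n + n)"
  let ?B = "set_tape n (mixed A i)" and ?B' = "set_tape n (mixed A (Suc i))"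
  let ?N = "card {l \<in> A. l < n \<and> {i, l} \<in> E}"
  have Bi: "?B (int i) = (if i \<in> A then 2 else 1)"
    using i by (auto simp: set_tape_int mixed_def)
  have 1: "step_tm (peel_tm k) (conf 1 ?p (set_tape n A) (int n) ?B (int i) (?o ?p)) =
      conf 2 ?p (set_tape n A) (int n - 1) ?B (int i) (?o ?p)"
    using Bi by (simp add: step_simps)
  have "{l \<in> A. l < n \<and> {i, l} \<in> E} = {l \<in> A. {i, l} \<in> E}" using A by auto
  then have N: "i \<in> peel k E A \<longleftrightarrow> i \<in> A \<and> k < ?N" by (simp add: peel_def)
  have upd: "?B(int i := (if i \<in> peel k E A then 2 else 1)) = ?B'"
    unfolding set_tape_upd[OF i] by (rule set_tape_cong) (auto simp: mixed_def less_Suc_eq Suc_le_eq le_less)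
  \<comment> \<open>The state is \<open>9 + k\<close> exactly when more than \<open>k\<close>
    neighbours have been counted.\<close>
  have 2: "step_tm (peel_tm k) (conf (8 + min (k + 1) ?N) ?p' (set_tape n A) (int n) ?B (int i)
         (?o ?p')) =
      conf 1 ?p' (set_tape n A) (int n) ?B' (int (Suc i)) (?o ?p')"
    unfolding upd[symmetric] N using Bi
    by (auto simp: step_simps min_def
             simp del: of_nat_add of_nat_mult)
  \<comment> \<open>The matrix has no row separators: the end of row \<open>i\<close> is the start
    of the next row.\<close>
  have p': "n + 1 + Suc i * n = n + 1 + i * n + n" by simp
  show ?thesis unfolding p'
    by (rule reaches_trans[OF reaches_step[OF 1]
          reaches_trans[OF return_loop[OF order_refl]
            reaches_trans[OF scan_loop[where f' = ?B and i = i and j = n, OF i Bi order_refl] reaches_step[OF 2] order_refl]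
          order_refl]]) simp
qed

lemma rows:
  assumes A: "A \<subseteq> {..<n}"
  shows "i \<le> n \<Longrightarrow> reach (i * (2 * n + 3))
     (conf 1 (int (n + 1)) (set_tape n A) (int n) (set_tape n A) 0
        (splice_tape (target A) out (int (n + 1))))
     (conf 1 (int (n + 1 + i * n)) (set_tape n A) (int n) (set_tape n (mixed A i)) (int i)
        (splice_tape (target A) out (int (n + 1 + i * n))))"
proof (induction i)
  case 0
  have "mixed A 0 = A" by (auto simp: mixed_def)
  then show ?case by (simp add: reaches_refl)
next
  case (Suc i)
  show ?case
    by (rule reaches_trans[OF Suc.IH row[OF _ A]]) (use Suc.prems in simp_all)
qed

section \<open>Complete rounds and their iteration\<close>

definition framed :: "(int \<Rightarrow> nat) \<Rightarrow> bool" where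
  "framed out \<longleftrightarrow> (\<forall>x \<le> int n. out x = input_tape x) \<and> (\<forall>x \<ge> int enc_len. out x = 0)"

lemma framed_target: "framed (target A)"
  unfolding framed_def target_def using graph_tape_prefix graph_tape_end by simp

lemma round:
  assumes A: "A \<subseteq> {..<n}" and out: "framed out"
  shows "reach (n * (2 * n + 3) + n + 1)
     (conf 1 (int (n + 1)) (set_tape n A) (int n) (set_tape n A) 0 out)
     (conf (if peel k E A = A then 3 else 4) (int enc_len) (set_tape n (peel k E A)) (- 1)
        (set_tape n (peel k E A)) (- 1) (target A))"
proof -
  let ?P = "peel k E A"
  have t: "framed (target A)" by (rule framed_target)
  \<comment> \<open>Old and new output agree before the matrix and behind it, so the splice is
    \<open>out\<close> at the start of the sweep and \<open>target A\<close> at its end.\<close>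
  have s1: "splice_tape (target A) out (int (n + 1)) = out"
    using out t by (auto simp: splice_tape_def framed_def fun_eq_iff)
  have s2: "splice_tape (target A) out (int enc_len) = target A"
    using out t by (auto simp: splice_tape_def framed_def fun_eq_iff)
  have P: "?P \<subseteq> A" by (auto simp: peel_def)
  have m: "mixed A n = ?P" using A P by (auto simp: mixed_def)
  have A': "A \<inter> {..<n} \<union> ?P \<inter> {n..} = A" using A P by auto
  have flag: "(\<exists>i<n. (i \<in> A) \<noteq> (i \<in> ?P)) \<longleftrightarrow> ?P \<noteq> A" using A P by auto
  have 1: "step_tm (peel_tm k) (conf 1 (int enc_len) (set_tape n A) (int n) (set_tape n ?P) (int n)
         (target A)) =
      conf 3 (int enc_len) (set_tape n A) (int n - 1) (set_tape n ?P) (int n - 1) (target A)"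
    by (simp add: step_simps)
  have 2: "reach n (conf 3 (int enc_len) (set_tape n A) (int n - 1) (set_tape n ?P) (int n - 1) (target A))
     (conf (if ?P = A then 3 else 4) (int enc_len) (set_tape n ?P) (- 1) (set_tape n ?P) (- 1) (target A))"
    using copy_loop[OF order_refl, of False "int enc_len" A ?P "target A"] A' flag
    by (cases "?P = A") (simp_all del: of_nat_add of_nat_mult)
  show ?thesis
    using reaches_trans[OF rows[OF A order_refl, of out, unfolded s1 s2 m]
        reaches_trans[OF reaches_step[OF 1] 2 order_refl]]
    by simp
qed

definition round_time :: nat where
  "round_time = n * (2 * n + 3) + n + 1 + (enc_len + n + 4)"

text \<open>Every round but the last removes a vertex, so there are at most
  \<open>card A + 1\<close> rounds. The last one has already written the graph induced on the stable
  set.\<close>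

lemma rounds:
  assumes "A \<subseteq> {..<n}" and "framed out"
    and "\<And>T. antifactor {1..k} {..<n} E T \<Longrightarrow> \<Union>T \<subseteq> A"
  shows "\<exists>S f g f' g'. max_antifactor {1..k} {..<n} E S \<and>
     reach ((card A + 1) * round_time)
       (conf 1 (int (n + 1)) (set_tape n A) (int n) (set_tape n A) 0 out)
       (conf 7 (int enc_len) f g f' g' (graph_tape n S))"
  using assms
proof (induction "card A" arbitrary: A out rule: less_induct)
  case less
  let ?P = "peel k E A"
  show ?case
  proof (cases "?P = A")
    case True
    let ?S = "induced_edges E A"
    have "step_tm (peel_tm k) (conf 3 (int enc_len) (set_tape n A) (- 1) (set_tape n A) (- 1) (target A))
        = conf 7 (int enc_len) (set_tape n A) (- 1) (set_tape n A) (- 1) (graph_tape n ?S)"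
      by (simp add: step_simps target_def)
    from reaches_trans[OF round[OF less.prems(1,2), unfolded True if_P[OF refl]]
        reaches_step[OF this]]
    have "reach ((card A + 1) * round_time)
       (conf 1 (int (n + 1)) (set_tape n A) (int n) (set_tape n A) 0 out)
       (conf 7 (int enc_len) (set_tape n A) (- 1) (set_tape n A) (- 1) (graph_tape n ?S))"
      by (simp add: round_time_def)
    moreover have "max_antifactor {1..k} {..<n} E ?S"
      by (rule max_antifactor_induced_edges[OF graph less.prems(1) True less.prems(3)])
    ultimately show ?thesis by blast
  next
    case False
    then have "?P \<subset> A" by (auto simp: peel_def)
    moreover have "finite A" using less.prems(1) finite_subset by blast
    ultimately have card: "card ?P < card A" by (simp add: psubset_card_mono)
    have sub: "?P \<subseteq> {..<n}" using less.prems(1) by (auto simp: peel_def)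
    have inv: "\<Union>T \<subseteq> ?P" if "antifactor {1..k} {..<n} E T" for T
      by (rule antifactor_Union_subset_peel[OF graph that less.prems(1) less.prems(3)[OF that]])
    obtain S f g f' g' where S: "max_antifactor {1..k} {..<n} E S"
      and r: "reach ((card ?P + 1) * round_time)
         (conf 1 (int (n + 1)) (set_tape n ?P) (int n) (set_tape n ?P) 0 (target A))
         (conf 7 (int enc_len) f g f' g' (graph_tape n S))"
      using less.hyps[OF card sub framed_target inv] by blast
    have 1: "reach round_time
       (conf 1 (int (n + 1)) (set_tape n A) (int n) (set_tape n A) 0 out)
       (conf 1 (int (n + 1)) (set_tape n ?P) (int n) (set_tape n ?P) 0 (target A))"
      by (rule reaches_trans[OF round[OF less.prems(1,2), unfolded if_not_P[OF False]] restart])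
         (simp_all add: round_time_def)
    \<comment> \<open>One round for the current set and \<open>card ?P + 1\<close> for the peeled
      one.\<close>
    have "(card ?P + 2) * round_time \<le> (card A + 1) * round_time"
      using card by (intro mult_right_mono) auto
    then have "round_time + (card ?P + 1) * round_time \<le> (card A + 1) * round_time" by simp
    from reaches_trans[OF 1 r this] S show ?thesis by blast
  qed
qed

section \<open>Start of the run and total running time\<close>

lemma initialise:
  "\<exists>out. framed out \<and> reach (enc_len + 3 * n + 5) (init_config (peel_tm k) (encode_graph (n, E)))
     (conf 1 (int (n + 1)) (set_tape n {..<n}) (int n) (set_tape n {..<n}) 0 out)"
proof -
  let ?U = "set_tape n UNIV"
  let ?out = "?U(int n := 1)"
  have U: "?U = set_tape n {..<n}" by (rule set_tape_cong) simp
  have blank: "tape_of [] = set_tape 0 UNIV" by (auto simp: tape_of_def set_tape_def fun_eq_iff)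
  have init: "init_config (peel_tm k) (encode_graph (n, E)) =
      conf 0 0 (set_tape 0 UNIV) 0 (set_tape 0 UNIV) 0 (set_tape 0 UNIV)"
    by (simp add: init_config_def conf_def peel_tm_def blank graph_tape_def eval_nat_numeral)
  \<comment> \<open>Entering state 4 rather than 3 makes the following copy pass, which changes
    nothing, end in a rewind instead of a halt.\<close>
  have 1: "step_tm (peel_tm k) (conf 0 (int n) ?U (int n) ?U (int n) ?U) =
      conf 4 (int n) ?U (int n - 1) ?U (int n - 1) ?out"
    using graph_tape_separator[of n E]
    by (simp add: step_simps)
  have UU: "UNIV \<inter> {..<n} \<union> UNIV \<inter> {n..} = UNIV" by auto
  have 2: "reach n (conf 4 (int n) ?U (int n - 1) ?U (int n - 1) ?out)
      (conf 4 (int n) ?U (- 1) ?U (- 1) ?out)"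
    using copy_loop[OF order_refl, of True "int n" UNIV UNIV ?out] unfolding UU by simp
  have 3: "reach (enc_len + n + 4) (conf 4 (int n) ?U (- 1) ?U (- 1) ?out)
      (conf 1 (int (n + 1)) ?U (int n) ?U 0 ?out)"
    by (rule restart) simp_all
  have "?out x = 0" if "int enc_len \<le> x" for x
  proof -
    have "int n < int enc_len" unfolding of_nat_less_iff by simp
    then have "int n < x" using that by (rule less_le_trans)
    then show ?thesis by (simp add: set_tape_def)
  qed
  then have "framed ?out"
    unfolding framed_def using graph_tape_prefix by simp
  moreover have "reach (enc_len + 3 * n + 5) (init_config (peel_tm k) (encode_graph (n, E)))
     (conf 1 (int (n + 1)) ?U (int n) ?U 0 ?out)"
    unfolding init
    by (rule reaches_trans[OF init_loop[OF order_refl]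
          reaches_trans[OF reaches_step[OF 1] reaches_trans[OF 2 3 order_refl] order_refl]]) simp
  ultimately show ?thesis unfolding U by blast
qed

lemma peel_tm_correct:
  "\<exists>S. max_antifactor {1..k} {..<n} E S \<and>
     outputs_within (peel_tm k) (encode_graph (n, E)) (encode_graph (n, S)) (20 * enc_len ^ 2)"
proof -
  obtain out where out: "framed out"
    and 1: "reach (enc_len + 3 * n + 5) (init_config (peel_tm k) (encode_graph (n, E)))
     (conf 1 (int (n + 1)) (set_tape n {..<n}) (int n) (set_tape n {..<n}) 0 out)"
    using initialise by blast
  have "\<Union>T \<subseteq> {..<n}" if "antifactor {1..k} {..<n} E T" for T
    using that graph by (auto simp: antifactor_def simple_graph_def)
  then obtain S f g f' g' where S: "max_antifactor {1..k} {..<n} E S"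
    and 2: "reach ((n + 1) * round_time)
       (conf 1 (int (n + 1)) (set_tape n {..<n}) (int n) (set_tape n {..<n}) 0 out)
       (conf 7 (int enc_len) f g f' g' (graph_tape n S))"
    using rounds[OF order_refl out] by auto
  define L where "L = enc_len"
  \<comment> \<open>With at most \<open>n + 1 \<le> L\<close> rounds of cost at most
    \<open>7 * L\<close>, the total is at most \<open>7 * L ^ 2 + 9 * L\<close>, below
    \<open>20 * L ^ 2\<close>.\<close>
  have "round_time \<le> 7 * L" by (simp add: L_def round_time_def algebra_simps)
  then have "(n + 1) * round_time \<le> L * (7 * L)" by (intro mult_mono) (auto simp: L_def)
  moreover have "L * 1 \<le> L * L" by (intro mult_left_mono) (auto simp: L_def)
  moreover have "enc_len + 3 * n + 5 \<le> 9 * L" by (simp add: L_def)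
  ultimately have "enc_len + 3 * n + 5 + (n + 1) * round_time \<le> 20 * L ^ 2"
    unfolding power2_eq_square by linarith
  note time = this[unfolded L_def]
  from reaches_halted[OF reaches_trans[OF 1 2 time]]
  show ?thesis using S
    by (auto simp: outputs_within_def conf_def peel_tm_def graph_tape_def)
qed

end

theorem theorem6p1:
  fixes k :: nat and X :: "nat set"
  assumes "k \<ge> 1" and "X = {1..k}"
  shows "Max_AntiFactor_poly_time X"
  unfolding Max_AntiFactor_poly_time_def poly_time_solvable_def
proof (rule exI[of _ "peel_tm k"], rule exI[of _ "[:0, 0, 20:]"], intro conjI ballI)
  show "wf_tm (peel_tm k)" by (rule wf_peel_tm)
  fix G assume "G \<in> graph_instances"
  then obtain n E where G: "G = (n, E)" and "simple_graph {..<n} E"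
    by (auto simp: graph_instances_def)
  then interpret peeling k n E by unfold_locales
  obtain S where S: "max_antifactor X {..<n} E S"
    and "outputs_within (peel_tm k) (encode_graph G) (encode_graph (n, S))
      (20 * length (encode_graph G) ^ 2)"
    using peel_tm_correct assms(2) by (auto simp: G length_encode_graph)
  \<comment> \<open>\<open>S\<close> itself witnesses feasibility, so the answer is never the empty
    string.\<close>
  moreover have "max_antifactor_answer X G (encode_graph (n, S))"
    using S by (auto simp: G max_antifactor_answer_def max_antifactor_def)
  ultimately show "\<exists>y. max_antifactor_answer X G y \<and> outputs_within (peel_tm k) (encode_graph G) y
      (poly [:0, 0, 20:] (length (encode_graph G)))"
    by (auto simp: power2_eq_square algebra_simps)
qed

end
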